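(* Let $k\ge 2$ be an integer. Then for any integer $r\ge 1$, the number of odd positive integers $n$ satisfying $\sigma(n)=kn$ and $\omega(n)\le r$ is at most $k\,4^{r^3}$.
   Context: $\sigma(n)$ denotes the sum of the positive divisors of the positive integer $n$, and $\omega(n)$ denotes the number of distinct prime factors of $n$. A positive integer $n$ with $\sigma(n)=kn$ is called $k$-perfect. *)

theory Defs
  imports "HOL-Number_Theory.Number_Theory"
begin

definition sigma :: "nat \<Rightarrow> nat" where
  "sigma n = (\<Sum>d | d dvd n. d)"

definition omega :: "nat \<Rightarrow> nat" where
  "omega n = card (prime_factors n)"

end

theory Submission
  imports Defs
begin

text \<open>
  If \<open>d \<sigma>(n) = a n\<close> with \<open>n\<close> odd, then some prime power \<open>p\<^sup>e\<close> exactly dividing \<open>n\<close> is bounded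
  in terms of \<open>d\<close> and \<open>\<omega>(n)\<close>. Dividing it out replaces \<open>d\<close> by \<open>d \<sigma>(p\<^sup>e)\<close>, so iteration bounds all
  prime powers; for \<open>d = 1\<close> and \<open>\<omega>(n) \<le> r\<close> every exponent is less than \<open>E = 2 ^ (r\<^sup>2 + 1)\<close>.

  Solutions are then counted as in Wirsing's theorem. Write \<open>n = A b\<close> where \<open>A\<close> collects the primes
  up to \<open>2 r\<close>. There are at most \<open>E ^ (r - 1)\<close> choices of \<open>A\<close>. Since \<open>b\<close> has at most \<open>r\<close> prime factors,
  all exceeding \<open>2 r\<close>, we have \<open>\<sigma>(b) < 2 b\<close>; hence for \<open>b \<noteq> 1\<close> the reduced denominator of
  \<open>\<sigma>(b) / b\<close> is not \<open>1\<close>. As \<open>A\<close> determines this fraction, it determines a prime divisor of \<open>b\<close>, and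
  repeating this shows that \<open>b\<close> is determined by \<open>A\<close> and a sequence of at most \<open>r\<close> exponents.
  The total is at most \<open>E ^ (2 r - 1) \<le> 4 ^ r\<^sup>3\<close>.
\<close>

section \<open>Multiplicativity of the divisor sum and its values at prime powers\<close>

lemma sigma_1 [simp]: "sigma (Suc 0) = 1"
  by (simp add: sigma_def)

lemma sigma_pos: "n > 0 \<Longrightarrow> sigma n > 0"
proof -
  assume "n > 0"
  then have "n \<le> (\<Sum>d | d dvd n. d)"
    by (intro member_le_sum) (auto simp: finite_divisors_nat)
  with \<open>n > 0\<close> show ?thesis by (simp add: sigma_def)
qed

lemma sigma_gt:
  assumes "n > 1" shows "sigma n > n"
proof -
  have "(\<Sum>d\<in>{1, n}. d) \<le> (\<Sum>d | d dvd n. d)"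
    using assms by (intro sum_mono2) (auto simp: finite_divisors_nat)
  then show ?thesis using assms by (simp add: sigma_def)
qed

text \<open>Multiplication pairs divisors of \<open>a\<close> and of \<open>b\<close> with divisors
  of \<open>a * b\<close>. The pairing is injective because coprimality recovers each factor of
  \<open>x * y\<close> as its gcd with \<open>a\<close> or with \<open>b\<close>.\<close>

lemma sigma_mult:
  fixes a b :: nat
  assumes "coprime a b"
  shows "sigma (a * b) = sigma a * sigma b"
proof -
  have gcd_eq: "gcd (x * y) a = x" if "coprime a b" "x dvd a" "y dvd b" for x y a b :: nat
  proof -
    have "coprime a y" using that by (metis coprime_divisors dvd_refl)
    then show ?thesis using that(2) by (simp add: gcd_mult_left_right_cancel gcd_nat.absorb1)
  qed
  have "bij_betw (\<lambda>(x, y). x * y) ({d. d dvd a} \<times> {d. d dvd b}) {d. d dvd a * b}"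
  proof (intro bij_betw_imageI)
    show "inj_on (\<lambda>(x, y). x * y) ({d. d dvd a} \<times> {d. d dvd b})"
    proof (clarsimp simp: inj_on_def)
      fix x y x' y'
      assume *: "x dvd a" "y dvd b" "x' dvd a" "y' dvd b" "x * y = x' * y'"
      have "x = gcd (x * y) a" "x' = gcd (x' * y') a"
        using gcd_eq [OF assms *(1,2)] gcd_eq [OF assms *(3,4)] by (simp_all only:)
      moreover have "y = gcd (y * x) b" "y' = gcd (y' * x') b"
        using gcd_eq [OF coprime_commute [THEN iffD1, OF assms] *(2,1)]
          gcd_eq [OF coprime_commute [THEN iffD1, OF assms] *(4,3)] by (simp_all only:)
      ultimately show "x = x' \<and> y = y'" using *(5) by (metis mult.commute)
    qed
  next
    show "(\<lambda>(x, y). x * y) ` ({d. d dvd a} \<times> {d. d dvd b}) = {d. d dvd a * b}"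
    proof (intro equalityI subsetI)
      fix z assume "z \<in> {d. d dvd a * b}"
      then obtain x y where "z = x * y" "x dvd a" "y dvd b"
        using division_decomp [of z a b] by auto
      then show "z \<in> (\<lambda>(x, y). x * y) ` ({d. d dvd a} \<times> {d. d dvd b})" by auto
    qed (auto intro: mult_dvd_mono)
  qed
  then have "sigma (a * b) = (\<Sum>(x, y)\<in>{d. d dvd a} \<times> {d. d dvd b}. x * y)"
    unfolding sigma_def by (subst sum.reindex_bij_betw [symmetric]) (auto simp: case_prod_unfold)
  also have "\<dots> = sigma a * sigma b"
    by (simp add: sigma_def sum_product sum.cartesian_product)
  finally show ?thesis .
qed

lemma sigma_prime_power:
  assumes "prime p"
  shows "sigma (p ^ e) = (\<Sum>i\<le>e. p ^ i)"
proof -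
  have "{d. d dvd p ^ e} = (\<lambda>i. p ^ i) ` {..e}"
    using divides_primepow_nat [OF assms] by auto
  moreover have "inj_on (\<lambda>i. p ^ i) {..e}"
    using assms prime_gt_1_nat by (auto simp: inj_on_def)
  ultimately show ?thesis by (simp add: sigma_def sum.reindex)
qed

section \<open>The ratio of \<open>sigma n\<close> to \<open>n\<close> as a product over
  primes\<close>

lemma sigma_prime_power_ratio:
  assumes "prime p"
  shows "real (sigma (p ^ e)) / real (p ^ e) = (1 - 1 / real p ^ Suc e) / (1 - 1 / real p)"
proof -
  have p: "real p > 1" using assms prime_gt_1_nat by simp
  have "real (sigma (p ^ e)) = (\<Sum>i<Suc e. real p ^ i)"
    by (simp add: sigma_prime_power assms lessThan_Suc_atMost)
  also have "\<dots> = (real p ^ Suc e - 1) / (real p - 1)"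
    using p by (subst geometric_sum) auto
  finally have "real (sigma (p ^ e)) = (real p ^ Suc e - 1) / (real p - 1)" .
  moreover have "1 - 1 / real p ^ Suc e = (real p ^ Suc e - 1) / real p ^ Suc e"
    "1 - 1 / real p = (real p - 1) / real p"
    using p by (simp_all add: diff_divide_distrib)
  ultimately show ?thesis using p by simp
qed

lemma sigma_prime_power_less:
  assumes "prime p"
  shows "sigma (p ^ e) < p ^ Suc e"
proof -
  have p: "p \<ge> 2" using assms prime_ge_2_nat by simp
  show ?thesis unfolding sigma_prime_power [OF assms]
  proof (induction e)
    case (Suc e)
    have "(\<Sum>i\<le>Suc e. p ^ i) < p ^ Suc e + p ^ Suc e" using Suc by simp
    also have "\<dots> = 2 * p ^ Suc e" by simp
    also have "\<dots> \<le> p * p ^ Suc e" using p by (intro mult_right_mono) auto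
    finally show ?case by simp
  qed (use p in simp)
qed

lemma sigma_prod_prime_powers:
  assumes "finite S" "\<And>p. p \<in> S \<Longrightarrow> prime p"
  shows "sigma (\<Prod>p\<in>S. p ^ f p) = (\<Prod>p\<in>S. sigma (p ^ f p))"
  using assms
proof (induction S rule: finite_induct)
  case (insert p S)
  have "coprime (p ^ f p) (\<Prod>q\<in>S. q ^ f q)"
    using insert by (intro prod_coprime_right coprime_power_left_iff [THEN iffD2] disjI1
        coprime_power_right_iff [THEN iffD2] primes_coprime) auto
  with insert show ?case by (simp add: sigma_mult)
qed simp

text \<open>In this form the exponents enter only through the numerators and the denominators depend
  on the primes alone, so the two can be estimated separately.\<close>

lemma sigma_ratio:
  assumes "n > 0"
  shows "real (sigma n) / real n =
    (\<Prod>p\<in>prime_factors n. (1 - 1 / real p ^ Suc (multiplicity p n)) / (1 - 1 / real p))"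
proof -
  have n: "n = (\<Prod>p\<in>prime_factors n. p ^ multiplicity p n)"
    using assms by (rule prime_factorization_nat)
  have "real (sigma n) / real n =
    (\<Prod>p\<in>prime_factors n. real (sigma (p ^ multiplicity p n)) / real (p ^ multiplicity p n))"
    by (subst n, subst (2) n, subst sigma_prod_prime_powers)
      (auto simp: prod_dividef)
  also have "\<dots> = (\<Prod>p\<in>prime_factors n. (1 - 1 / real p ^ Suc (multiplicity p n)) / (1 - 1 / real p))"
    by (intro prod.cong sigma_prime_power_ratio) auto
  finally show ?thesis .
qed

text \<open>The Weierstrass product inequality; it turns an upper bound for a sum of reciprocals
  into a lower bound for a product.\<close>

lemma prod_one_minus_ge:
  fixes x :: "'a \<Rightarrow> real"
  assumes "\<And>i. i \<in> S \<Longrightarrow> 0 \<le> x i \<and> x i \<le> 1"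
  shows "1 - (\<Sum>i\<in>S. x i) \<le> (\<Prod>i\<in>S. 1 - x i)"
  using assms
proof (induction S rule: infinite_finite_induct)
  case (insert i S)
  have "1 - (\<Sum>i\<in>insert i S. x i) \<le> (1 - (\<Sum>i\<in>S. x i)) - x i * (\<Prod>i\<in>S. 1 - x i)"
    using insert mult_left_le [of "\<Prod>i\<in>S. 1 - x i" "x i"]
    by (force intro: prod_le_1)
  also have "\<dots> \<le> (\<Prod>i\<in>S. 1 - x i) - x i * (\<Prod>i\<in>S. 1 - x i)"
    using insert by simp
  finally show ?case using insert by (simp add: algebra_simps)
qed auto

text \<open>The product cancels the denominators in \<open>sigma_ratio\<close>, leaving numerators
  below 1, of which there is at least one since \<open>n > 1\<close>. This is the classical estimate
  that \<open>sigma n / n\<close> is less than \<open>n\<close> divided by its totient.\<close>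

lemma sigma_ratio_less:
  assumes "n > 1"
  shows "real (sigma n) / real n * (\<Prod>p\<in>prime_factors n. 1 - 1 / real p) < 1"
proof -
  have "n > 0" using assms by simp
  have gt1: "real p > 1" if "p \<in> prime_factors n" for p
    using that prime_gt_1_nat by (auto simp: in_prime_factors_iff)
  have ne: "prime_factors n \<noteq> {}"
    using assms by (simp add: prime_factorization_empty_iff)
  have "real (sigma n) / real n * (\<Prod>p\<in>prime_factors n. 1 - 1 / real p) =
     (\<Prod>p\<in>prime_factors n. 1 - 1 / real p ^ Suc (multiplicity p n))"
    unfolding sigma_ratio [OF \<open>n > 0\<close>] prod.distrib [symmetric]
  proof (intro prod.cong refl)
    fix p assume "p \<in> prime_factors n"
    then have "1 - 1 / real p \<noteq> 0" using gt1 [of p] by simp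
    then show "(1 - 1 / real p ^ Suc (multiplicity p n)) / (1 - 1 / real p) * (1 - 1 / real p)
       = 1 - 1 / real p ^ Suc (multiplicity p n)"
      by (rule nonzero_eq_divide_eq [THEN iffD1]) simp
  qed
  also have "\<dots> < (\<Prod>p\<in>prime_factors n. 1)"
  proof -
    have less: "0 \<le> 1 - 1 / real p ^ Suc (multiplicity p n) \<and>
        1 - 1 / real p ^ Suc (multiplicity p n) < 1" if "p \<in> prime_factors n" for p
    proof -
      have "real p ^ Suc (multiplicity p n) > 1" using gt1 [OF that] by (intro one_less_power) auto
      then show ?thesis by simp
    qed
    obtain q where "q \<in> prime_factors n" using ne by blast
    then show ?thesis
    proof (rule prod_mono_strict)
      show "1 - 1 / real q ^ Suc (multiplicity q n) < 1"
        using less [OF \<open>q \<in> prime_factors n\<close>] by blast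
      show "0 \<le> 1 - 1 / real p ^ Suc (multiplicity p n) \<and>
          1 - 1 / real p ^ Suc (multiplicity p n) \<le> 1" if "p \<in> prime_factors n" for p
        using less [OF that] by linarith
    qed simp_all
  qed
  finally show ?thesis by simp
qed

section \<open>Existence of a small prime power component\<close>

lemma exists_small_prime_power_coprime:
  fixes a d n k :: nat
  assumes eq: "d * sigma n = a * n" and "d > 0" and "coprime a d"
    and "odd n" and "n > 1" and k: "omega n \<le> k"
  shows "\<exists>p\<in>prime_factors n. p ^ Suc (multiplicity p n) \<le> (2 * k * d) ^ (2 ^ omega n)"
proof -
  define S where "S = prime_factors n"
  define P where "P T = (\<Prod>p\<in>T. p)" for T :: "nat set"
  define Q where "Q T = (\<Prod>p\<in>T. p - 1)" for T :: "nat set"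
  define R where "R T = (\<Prod>p\<in>T. 1 - 1 / real p)" for T :: "nat set"
  have [simp]: "finite S" by (simp add: S_def)
  have fin: "finite T" if "T \<subseteq> S" for T using that \<open>finite S\<close> by (rule finite_subset)
  have cardS: "card S = omega n" by (simp add: S_def omega_def)
  have S_gt1: "p > 1" and S_odd: "odd p" if "p \<in> S" for p
  proof -
    have "prime p" "p dvd n" using that by (auto simp: S_def)
    then show "p > 1" "odd p" using \<open>odd n\<close> dvd_trans prime_gt_1_nat by blast+
  qed
  have "S \<noteq> {}" using \<open>n > 1\<close> by (simp add: S_def prime_factorization_empty_iff)
  then have "omega n > 0" using cardS by (metis \<open>finite S\<close> card_gt_0_iff)
  then have "k > 0" using k by simp
  \<comment> \<open>Coprimality makes \<open>d\<close> a divisor of the odd number \<open>n\<close>;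
    oddness of \<open>d\<close> is what the parity argument below relies on.\<close>
  have "d dvd a * n" by (simp flip: eq)
  then have "d dvd n"
    using coprime_commute [THEN iffD1, OF \<open>coprime a d\<close>] by (simp add: coprime_dvd_mult_right_iff)
  then have "odd d" using \<open>odd n\<close> by (blast intro: dvd_trans)
  \<comment> \<open>This makes the empty set \<open>good\<close>, so a maximal \<open>good\<close>
    set exists.\<close>
  have "a > d"
  proof -
    have "d * n < a * n" using sigma_gt [OF \<open>n > 1\<close>] \<open>d > 0\<close> by (simp flip: eq)
    then show ?thesis by simp
  qed
  have ratio: "real (sigma n) / real n = real a / real d"
    using eq \<open>n > 1\<close> \<open>d > 0\<close> by (simp add: field_simps flip: of_nat_mult)
  have P_pos: "P T > 0" if "T \<subseteq> S" for T
    unfolding P_def using that S_gt1 by (intro prod_pos) force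
  have R_pos: "R T > 0" if "T \<subseteq> S" for T
    unfolding R_def using that S_gt1 by (intro prod_pos) force
  have R_eq: "R T = real (Q T) / real (P T)" if "T \<subseteq> S" for T
    unfolding R_def P_def Q_def of_nat_prod prod_dividef [symmetric]
  proof (intro prod.cong refl)
    fix p assume "p \<in> T"
    then have "p > 1" using that S_gt1 by blast
    then show "1 - 1 / real p = real (p - 1) / real p" by (simp add: field_simps of_nat_diff)
  qed
  have R_S: "real a * R S < real d"
    using sigma_ratio_less [OF \<open>n > 1\<close>] \<open>d > 0\<close> unfolding ratio
    by (simp add: R_def S_def field_simps)

  text \<open>
    The subset \<open>T\<close> below is maximal such that \<open>\<Prod>(1 - 1/p)\<close> over \<open>T\<close> still exceeds \<open>d/a\<close>, subject to a size
    bound. One more prime \<open>q\<close> of controlled size pushes the product down to \<open>d/a\<close>, and equality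
    is impossible by parity. The gap below \<open>d/a\<close> must be made up by the factors \<open>1 - 1/p\<^sup>e\<^sup>+\<^sup>1\<close> of
    \<open>\<sigma>(n)/n\<close>, which forces some \<open>p\<^sup>e\<^sup>+\<^sup>1\<close> to be small.
  \<close>
  define good where "good T \<longleftrightarrow> a * Q T > d * P T \<and> 2 * k * d * P T \<le> (2 * k * d) ^ (2 ^ card T)" for T
  have "good {}" using \<open>a > d\<close> by (simp add: good_def P_def Q_def)
  then have "{T \<in> Pow S. good T} \<noteq> {}" by auto
  then obtain T where T: "T \<subseteq> S" "good T" and T_max: "\<And>T'. T' \<subseteq> S \<Longrightarrow> good T' \<Longrightarrow> T \<subseteq> T' \<Longrightarrow> T = T'"
    using finite_has_maximal [of "{T \<in> Pow S. good T}"] by auto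
  define D where "D = d * P T"
  have "D > 0" using \<open>d > 0\<close> P_pos [OF T(1)] by (simp add: D_def)

  \<comment> \<open>Otherwise the at most \<open>k\<close> primes outside \<open>T\<close> have
    reciprocals summing to at most \<open>1 / (D + 1)\<close>, so \<open>R (S - T)\<close> is at
    least \<open>D / (D + 1)\<close>. Strictness in \<open>good T\<close> gains a full unit between
    integers, so \<open>a * R T\<close> is at least \<open>(D + 1) / P T\<close>. Multiplying gives
    \<open>a * R S \<ge> d\<close>, against \<open>R_S\<close>.\<close>
  have "\<exists>q\<in>S - T. q \<le> k * (D + 1)"
  proof (rule ccontr)
    assume "\<not> ?thesis"
    then have big: "q > k * (D + 1)" if "q \<in> S - T" for q using that by (meson not_le)
    have "(\<Sum>q\<in>S - T. 1 / real q) \<le> (\<Sum>q\<in>S - T. 1 / real (k * (D + 1)))"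
    proof (intro sum_mono)
      fix q assume "q \<in> S - T"
      then have "real (k * (D + 1)) \<le> real q" using big by (intro of_nat_mono) force
      then show "1 / real q \<le> 1 / real (k * (D + 1))"
        using \<open>k > 0\<close> by (intro frac_le) (auto simp: add_pos_nonneg)
    qed
    also have "\<dots> = real (card (S - T)) / real (k * (D + 1))" by simp
    also have "\<dots> \<le> real k / real (k * (D + 1))"
    proof (intro divide_right_mono)
      have "card (S - T) \<le> k" using k cardS card_mono [of S "S - T"] by auto
      then show "real (card (S - T)) \<le> real k" by simp
    qed simp
    also have "\<dots> = 1 / (real D + 1)" using \<open>k > 0\<close> unfolding of_nat_mult of_nat_add by simp
    finally have "1 - 1 / (real D + 1) \<le> 1 - (\<Sum>q\<in>S - T. 1 / real q)" by linarith
    also have "\<dots> \<le> R (S - T)"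
      unfolding R_def
    proof (rule prod_one_minus_ge)
      fix q assume "q \<in> S - T"
      then show "0 \<le> 1 / real q \<and> 1 / real q \<le> 1" using S_gt1 [of q] by simp
    qed
    finally have "real D / (real D + 1) \<le> R (S - T)"
      by (simp add: diff_divide_eq_iff add_nonneg_eq_0_iff)
    moreover have "(real D + 1) / real (P T) \<le> real a * R T"
    proof -
      have "D + 1 \<le> a * Q T" using T(2) by (simp add: good_def D_def)
      then have "real D + 1 \<le> real a * real (Q T)" by (metis of_nat_1 of_nat_add of_nat_le_iff of_nat_mult)
      then show ?thesis using R_eq [OF T(1)] P_pos [OF T(1)] by (simp add: divide_right_mono)
    qed
    ultimately have "(real D + 1) / real (P T) * (real D / (real D + 1)) \<le> (real a * R T) * R (S - T)"
      using R_pos [OF T(1)] by (intro mult_mono) auto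
    also have "\<dots> = real a * R S"
      using T(1) by (simp add: R_def prod.subset_diff [of T S] mult.commute)
    also have "(real D + 1) / real (P T) * (real D / (real D + 1)) = real d"
      using P_pos [OF T(1)] by (simp add: D_def add_nonneg_eq_0_iff)
    finally show False using R_S by simp
  qed
  then obtain q where q: "q \<in> S" "q \<notin> T" "q \<le> k * (D + 1)" by auto
  define U where "U = insert q T"
  have U: "U \<subseteq> S" using T q by (simp add: U_def)
  define D' where "D' = d * P U"
  have "D' > 0" using \<open>d > 0\<close> P_pos [OF U] by (simp add: D'_def)
  have D'_eq: "D' = D * q" using q fin [OF T(1)] by (simp add: D'_def D_def U_def P_def)
  \<comment> \<open>Since \<open>q\<close> is at most \<open>2 * k * D\<close>, adjoining it at most
    squares \<open>2 * k * D\<close>; this is why the exponent in \<open>good\<close> doubles with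
    each prime.\<close>
  have D'_le: "2 * k * D' \<le> (2 * k * d) ^ (2 ^ card U)"
  proof -
    have "2 * k * D' \<le> (2 * k * D) * (k * (D + 1))" using q by (simp add: D'_eq)
    also have "\<dots> \<le> (2 * k * D) * (2 * k * D)" using \<open>D > 0\<close> by (intro mult_left_mono) auto
    also have "\<dots> \<le> (2 * k * d) ^ (2 ^ card T) * (2 * k * d) ^ (2 ^ card T)"
      using T(2) by (intro mult_mono) (auto simp: good_def D_def mult.assoc)
    also have "\<dots> = (2 * k * d) ^ (2 ^ card U)"
      using q fin [OF T(1)] by (simp add: U_def mult_2 flip: power_add)
    finally show ?thesis .
  qed
  \<comment> \<open>By maximality \<open>U\<close> is not \<open>good\<close>, and its size bound
    holds, so the strict inequality must fail. Equality is excluded because \<open>d * P U\<close>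
    is odd while \<open>Q U\<close> contains the even factor \<open>q - 1\<close>.\<close>
  have "a * Q U < d * P U"
  proof -
    have "\<not> good U" using T_max [OF U] q by (auto simp: U_def)
    then have "a * Q U \<le> d * P U" using D'_le by (simp add: good_def D'_def mult.assoc)
    moreover have "odd (P U)" unfolding P_def
      using U S_odd fin [OF U] by (auto simp: even_prod_iff)
    moreover have "even (Q U)"
    proof -
      have "q - 1 dvd Q U" unfolding Q_def using fin [OF U] by (intro dvd_prodI) (auto simp: U_def)
      moreover have "even (q - 1)" using S_odd [OF q(1)] by simp
      ultimately show ?thesis by (rule dvd_trans[rotated])
    qed
    ultimately show ?thesis using \<open>odd d\<close> by (metis even_mult_iff le_neq_implies_less)
  qed
  then have aQ: "real a * real (Q U) + 1 \<le> real D'"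
    unfolding D'_def by (metis Suc_eq_plus1 Suc_leI of_nat_1 of_nat_add of_nat_le_iff of_nat_mult)

  \<comment> \<open>If all these powers were larger, the product of \<open>1 - x p\<close> over
    \<open>U\<close> would exceed \<open>1 - 1 / D'\<close>. It is also at most
    \<open>sigma n / n * R U\<close>, because the factors of \<open>sigma n / n\<close> at primes
    outside \<open>U\<close> are at least 1. That quantity is \<open>a * Q U / D'\<close>, at most
    \<open>(D' - 1) / D'\<close> by the integer gap \<open>aQ\<close>.\<close>
  have "\<exists>p\<in>U. p ^ Suc (multiplicity p n) \<le> 2 * k * D'"
  proof (rule ccontr)
    assume "\<not> ?thesis"
    then have big: "p ^ Suc (multiplicity p n) > 2 * k * D'" if "p \<in> U" for p using that by (meson not_le)
    define x where "x p = 1 / real p ^ Suc (multiplicity p n)" for p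
    have "(\<Sum>p\<in>U. x p) \<le> (\<Sum>p\<in>U. 1 / real (2 * k * D'))"
    proof (intro sum_mono)
      fix p assume "p \<in> U"
      then have "real (2 * k * D') \<le> real (p ^ Suc (multiplicity p n))"
        using big by (intro of_nat_mono) force
      then show "x p \<le> 1 / real (2 * k * D')"
        unfolding x_def of_nat_power [symmetric] using \<open>k > 0\<close> \<open>D' > 0\<close>
        by (intro frac_le) auto
    qed
    also have "\<dots> = real (card U) / real (2 * k * D')" by simp
    also have "\<dots> \<le> real k / real (2 * k * D')"
    proof (intro divide_right_mono)
      have "card U \<le> k" using k cardS card_mono [of S U] U by auto
      then show "real (card U) \<le> real k" by simp
    qed simp
    also have "\<dots> = 1 / (2 * real D')" using \<open>k > 0\<close> by simp
    also have "\<dots> < 1 / real D'" using \<open>D' > 0\<close> by (simp add: field_simps)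
    finally have "1 - 1 / real D' < 1 - (\<Sum>p\<in>U. x p)" by simp
    also have "\<dots> \<le> (\<Prod>p\<in>U. 1 - x p)"
    proof (intro prod_one_minus_ge)
      fix p assume "p \<in> U"
      then have "p > 1" using U S_gt1 by blast
      then have "real p ^ Suc (multiplicity p n) \<ge> 1" by (intro one_le_power) auto
      then show "0 \<le> x p \<and> x p \<le> 1" by (simp add: x_def)
    qed
    also have "\<dots> = (\<Prod>p\<in>U. (1 - x p) / (1 - 1 / real p)) * R U"
      unfolding R_def prod.distrib [symmetric]
    proof (intro prod.cong refl)
      fix p assume "p \<in> U"
      then have "1 - 1 / real p \<noteq> 0" using U S_gt1 by force
      then show "1 - x p = (1 - x p) / (1 - 1 / real p) * (1 - 1 / real p)" by simp
    qed
    also have "\<dots> \<le> (\<Prod>p\<in>S. (1 - x p) / (1 - 1 / real p)) * R U"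
    proof (intro mult_right_mono prod_mono2)
      fix p assume "p \<in> S - U"
      then have p: "real p > 1" using S_gt1 by force
      then have "real p ^ 1 \<le> real p ^ Suc (multiplicity p n)" by (intro power_increasing) auto
      then have "x p \<le> 1 / real p" unfolding x_def using p by (intro divide_left_mono) auto
      then show "1 \<le> (1 - x p) / (1 - 1 / real p)" using p by simp
    next
      fix p assume "p \<in> U"
      then have p: "real p > 1" using U S_gt1 by force
      then have "real p ^ Suc (multiplicity p n) \<ge> 1" by (intro one_le_power) auto
      then show "0 \<le> (1 - x p) / (1 - 1 / real p)" using p by (simp add: x_def)
    qed (use U R_pos in \<open>auto simp: less_imp_le\<close>)
    also have "\<dots> = real a / real d * R U"
      using sigma_ratio [of n] \<open>n > 1\<close> by (simp add: ratio S_def x_def)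
    also have "\<dots> = real a * real (Q U) / real D'"
      using R_eq [OF U] by (simp add: D'_def)
    also have "\<dots> \<le> (real D' - 1) / real D'"
      using aQ by (intro divide_right_mono) auto
    finally show False using \<open>D' > 0\<close> by (simp add: diff_divide_distrib)
  qed
  then obtain p where p: "p \<in> U" "p ^ Suc (multiplicity p n) \<le> 2 * k * D'" by blast
  have "p ^ Suc (multiplicity p n) \<le> (2 * k * d) ^ (2 ^ card U)" using p(2) D'_le by (rule le_trans)
  also have "\<dots> \<le> (2 * k * d) ^ (2 ^ omega n)"
  proof (intro power_increasing)
    show "card U \<le> omega n" using U card_mono [of S U] by (simp add: cardS)
  qed (use \<open>k > 0\<close> \<open>d > 0\<close> in auto)
  finally show ?thesis using p(1) U by (auto simp: S_def)
qed

text \<open>Cancelling \<open>gcd a d\<close> leads to the coprime case without increasing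
  \<open>d\<close>, and the bound is monotone in \<open>d\<close>. The iteration needs this form,
  since multiplying \<open>d\<close> by \<open>sigma (p ^ e)\<close> can destroy
  coprimality.\<close>

lemma exists_small_prime_power:
  fixes a d n k :: nat
  assumes eq: "d * sigma n = a * n" and "d > 0"
    and "odd n" and "n > 1" and k: "omega n \<le> k"
  shows "\<exists>p\<in>prime_factors n. p ^ Suc (multiplicity p n) \<le> (2 * k * d) ^ (2 ^ omega n)"
proof -
  define g where "g = gcd a d"
  obtain a' d' where g: "a = a' * g" "d = d' * g" "coprime a' d'"
    using gcd_coprime_exists [of a d] \<open>d > 0\<close> unfolding g_def by auto
  have "g > 0" "d' > 0" using \<open>d > 0\<close> unfolding g(2) by simp_all
  have "g * (d' * sigma n) = g * (a' * n)" using eq unfolding g(1,2) by (simp only: ac_simps)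
  then have "d' * sigma n = a' * n" using \<open>g > 0\<close> by simp
  then obtain p where p: "p \<in> prime_factors n"
    and le: "p ^ Suc (multiplicity p n) \<le> (2 * k * d') ^ (2 ^ omega n)"
    using exists_small_prime_power_coprime [OF _ \<open>d' > 0\<close> g(3) \<open>odd n\<close> \<open>n > 1\<close> k] by blast
  note le
  also have "(2 * k * d') ^ (2 ^ omega n) \<le> (2 * k * d) ^ (2 ^ omega n)"
  proof (rule power_mono)
    have "d' \<le> d" using \<open>g > 0\<close> unfolding g(2) by simp
    then show "2 * k * d' \<le> 2 * k * d" by simp
  qed simp
  finally show ?thesis using p by blast
qed

section \<open>Bounding all prime powers and exponents by iteration\<close>

lemma prime_power_cofactor:
  fixes n p :: nat
  assumes "n > 0" "p \<in> prime_factors n"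
  obtains m where "n = p ^ multiplicity p n * m" "m > 0" "coprime (p ^ multiplicity p n) m"
    "prime_factors m = prime_factors n - {p}" "omega n = Suc (omega m)"
    "\<And>q. q \<in> prime_factors m \<Longrightarrow> multiplicity q m = multiplicity q n"
proof -
  have p: "prime p" "p dvd n" using assms by auto
  obtain m where m: "n = p ^ multiplicity p n * m" "\<not> p dvd m"
    using multiplicity_decompose' [of n p] assms p by (metis not_prime_unit not_gr_zero)
  have "m > 0" using m(2) by (auto intro: Nat.gr0I)
  have e: "multiplicity p n > 0" using assms p by (simp add: prime_multiplicity_gt_zero_iff)
  have pf: "prime_factors m = prime_factors n - {p}"
  proof -
    have "prime_factors n = prime_factors (p ^ multiplicity p n) \<union> prime_factors m"
      by (subst m(1), subst prime_factors_product) (use \<open>m > 0\<close> p in auto)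
    moreover have "prime_factors (p ^ multiplicity p n) = {p}"
      using e p by (simp add: prime_factors_power prime_prime_factors)
    ultimately show ?thesis using m(2) by auto
  qed
  show ?thesis
  proof (rule that [OF m(1) \<open>m > 0\<close> _ pf])
    show "coprime (p ^ multiplicity p n) m"
      using m(2) p by (simp add: prime_imp_coprime)
    show "omega n = Suc (omega m)"
      unfolding omega_def pf by (rule card.remove) (use assms in auto)
    show "multiplicity q m = multiplicity q n" if "q \<in> prime_factors m" for q
    proof -
      have "prime q" "q \<noteq> p" using that pf by auto
      then have "multiplicity q (p ^ multiplicity p n) = 0"
        using p primes_dvd_imp_eq prime_dvd_power by (blast intro: not_dvd_imp_multiplicity_0)
      moreover have "multiplicity q n = multiplicity q (p ^ multiplicity p n * m)"
        using m(1) by (rule arg_cong)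
      moreover have "\<dots> = multiplicity q (p ^ multiplicity p n) + multiplicity q m"
        using \<open>prime q\<close> \<open>m > 0\<close> p by (intro prime_elem_multiplicity_mult_distrib) auto
      ultimately show ?thesis by simp
    qed
  qed
qed

text \<open>Induction on the number of primes with \<open>k\<close> fixed. Removing the small
  component \<open>p ^ e\<close> multiplies \<open>d\<close> by \<open>sigma (p ^ e)\<close>, which
  is less than \<open>p ^ Suc e\<close>. So \<open>L = 2 * k * d\<close> is replaced by at most
  \<open>L ^ (2 ^ omega n + 1)\<close>, and these exponents multiply up along the induction.\<close>

lemma all_prime_powers_bounded:
  fixes a d n k :: nat
  assumes "d * sigma n = a * n" "d > 0" "odd n" "omega n \<le> k" "q \<in> prime_factors n"
  shows "q ^ Suc (multiplicity q n) \<le> (2 * k * d) ^ (\<Prod>i=1..omega n. 2 ^ i + 1)"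
  using assms
proof (induction "omega n" arbitrary: a d n)
  case 0
  then show ?case by (simp add: omega_def)
next
  case (Suc j)
  define L where "L = 2 * k * d"
  have "n > 0" using Suc.prems by (auto intro: Nat.gr0I)
  moreover have "n \<noteq> 1" using Suc.prems(5) by (auto simp del: in_prime_factors_iff)
  ultimately have "n > 1" by simp
  have "L > 0" using Suc.hyps(2) Suc.prems by (auto simp: L_def)
  obtain p where p: "p \<in> prime_factors n" and "p ^ Suc (multiplicity p n) \<le> L ^ (2 ^ omega n)"
    using exists_small_prime_power [of d n a k] Suc.prems \<open>n > 1\<close> unfolding L_def by blast
  then have p_le: "p ^ Suc (multiplicity p n) \<le> L ^ (2 ^ Suc j)" using Suc.hyps(2) by simp
  define e where "e = multiplicity p n"
  obtain m where m: "n = p ^ e * m" "m > 0" "coprime (p ^ e) m"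
    "prime_factors m = prime_factors n - {p}" "omega n = Suc (omega m)"
    "\<And>q. q \<in> prime_factors m \<Longrightarrow> multiplicity q m = multiplicity q n"
    using prime_power_cofactor [OF \<open>n > 0\<close> p] unfolding e_def by metis
  have prod_pos: "(\<Prod>i=1..j. 2 ^ i + 1 :: nat) \<ge> 1" by (simp add: Suc_le_eq prod_pos)
  have prod_eq: "(\<Prod>i=1..omega n. 2 ^ i + 1 :: nat) = (2 ^ Suc j + 1) * (\<Prod>i=1..j. 2 ^ i + 1)"
    by (simp flip: Suc.hyps(2))
  show ?case
  proof (cases "q = p")
    case True
    note p_le
    also have "L ^ (2 ^ Suc j) \<le> L ^ ((2 ^ Suc j + 1) * (\<Prod>i=1..j. 2 ^ i + 1))"
      using \<open>L > 0\<close> mult_le_mono [OF _ prod_pos, of "2 ^ Suc j" "2 ^ Suc j + 1"]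
      by (intro power_increasing) auto
    finally show ?thesis using True unfolding prod_eq L_def by simp
  next
    case False
    have "prime p" using p by auto
    have "d * sigma (p ^ e) * sigma m = a * p ^ e * m"
      using Suc.prems(1) sigma_mult [OF m(3)] by (subst (asm) (1 2) m(1)) (simp add: ac_simps)
    moreover have "d * sigma (p ^ e) > 0"
      using \<open>d > 0\<close> \<open>prime p\<close> by (simp add: sigma_pos prime_gt_0_nat)
    moreover have "odd m" using Suc.prems(3) m(1) by auto
    ultimately have "q ^ Suc (multiplicity q m) \<le> (2 * k * (d * sigma (p ^ e))) ^ (\<Prod>i=1..omega m. 2 ^ i + 1)"
      using Suc.hyps(2) Suc.prems(4,5) m(4,5) False by (intro Suc.hyps(1)) auto
    also have "\<dots> \<le> (L ^ (2 ^ Suc j + 1)) ^ (\<Prod>i=1..j. 2 ^ i + 1)"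
    proof -
      have "sigma (p ^ e) \<le> L ^ (2 ^ Suc j)"
        using sigma_prime_power_less [OF \<open>prime p\<close>, of e] p_le unfolding e_def by linarith
      then have "2 * k * (d * sigma (p ^ e)) \<le> L ^ (2 ^ Suc j + 1)"
        by (simp add: L_def mult.assoc)
      moreover have "omega m = j" using m(5) Suc.hyps(2) by simp
      ultimately show ?thesis by (simp add: power_mono)
    qed
    also have "\<dots> = L ^ (\<Prod>i=1..omega n. 2 ^ i + 1)"
      unfolding prod_eq by (simp only: power_mult)
    finally show ?thesis using m(6) [of q] m(4) Suc.prems(5) False by (simp add: L_def)
  qed
qed

text \<open>Passing from \<open>r\<close> to \<open>r + 1\<close> multiplies the left side by at
  most \<open>2 ^ (2 * r + 1)\<close>, exactly the growth of the right side. The estimate uses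
  \<open>r + 3 \<le> 2 * r + 1\<close>, so the induction starts at 2 and \<open>r = 1\<close> is
  checked apart.\<close>

lemma prod_two_power_plus_one_le:
  assumes "r \<ge> 1"
  shows "r * (\<Prod>i=1..r. 2 ^ i + 1) \<le> (2 :: nat) ^ (r\<^sup>2 + 1)"
proof (cases "r = 1")
  case False
  then have "r \<ge> 2" using assms by simp
  then show ?thesis
  proof (induction r rule: dec_induct)
    case base
    then show ?case by (simp add: numeral_2_eq_2)
  next
    case (step r)
    have "Suc r * (2 ^ Suc r + 1) \<le> (2 * r) * (2 * 2 ^ Suc r)"
      using step(1) by (intro mult_mono) auto
    also have "\<dots> = r * 2 ^ (r + 3)" by (simp add: power_add)
    also have "\<dots> \<le> r * 2 ^ (2 * r + 1)" using step(1) by (intro mult_left_mono power_increasing) auto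
    finally have "Suc r * (2 ^ Suc r + 1) * (\<Prod>i=1..r. 2 ^ i + 1)
        \<le> r * 2 ^ (2 * r + 1) * (\<Prod>i=1..r. 2 ^ i + 1)"
      by (rule mult_right_mono) simp
    also have "\<dots> = 2 ^ (2 * r + 1) * (r * (\<Prod>i=1..r. 2 ^ i + 1))" by simp
    also have "\<dots> \<le> 2 ^ (2 * r + 1) * 2 ^ (r\<^sup>2 + 1)" using step by (intro mult_left_mono) auto
    also have "\<dots> = 2 ^ ((Suc r)\<^sup>2 + 1)"
      by (simp add: power2_eq_square flip: power_add)
    also have "Suc r * (2 ^ Suc r + 1) * (\<Prod>i=1..r. 2 ^ i + 1) = Suc r * (\<Prod>i=1..Suc r. 2 ^ i + 1 :: nat)"
      by (simp only: prod.nat_ivl_Suc' One_nat_def le_add2 Suc_le_mono le0 ac_simps)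
    finally show ?case .
  qed
qed simp

text \<open>The case \<open>d = 1\<close> of the iteration. Oddness gives \<open>q \<ge> 3\<close>,
  and \<open>2 * r \<le> 3 ^ r\<close>, so both sides can be compared as powers of 3 and only the
  exponents remain.\<close>

lemma multiplicity_bound:
  fixes n k r :: nat
  assumes "n > 0" "odd n" "sigma n = k * n" "omega n \<le> r" "q \<in> prime_factors n"
  shows "multiplicity q n < 2 ^ (r\<^sup>2 + 1)"
proof -
  have "omega n > 0" using assms(5) by (auto simp: omega_def card_gt_0_iff)
  then have "r \<ge> 1" using assms(4) by simp
  have "prime q" "q dvd n" using assms(5) by auto
  then have "q \<ge> 2" "odd q" using assms(2) dvd_trans prime_ge_2_nat by blast+
  then have "q \<ge> 3" by (cases "q = 2") auto
  have "2 * r \<le> (3 :: nat) ^ r"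
  proof (induction r)
    case (Suc r)
    have "2 * Suc r = 2 * r + 2" by simp
    also have "\<dots> \<le> 3 ^ r + 2 * 3 ^ r" using Suc by (intro add_mono) auto
    also have "\<dots> = 3 ^ Suc r" by simp
    finally show ?case .
  qed simp
  have "3 ^ Suc (multiplicity q n) \<le> q ^ Suc (multiplicity q n)"
    using \<open>q \<ge> 3\<close> by (intro power_mono) auto
  also have "\<dots> \<le> (2 * r * 1) ^ (\<Prod>i=1..omega n. 2 ^ i + 1)"
    by (rule all_prime_powers_bounded [of _ _ k]) (use assms in auto)
  also have "\<dots> \<le> (3 ^ r) ^ (\<Prod>i=1..omega n. 2 ^ i + 1)"
    using \<open>2 * r \<le> 3 ^ r\<close> by (intro power_mono) auto
  also have "\<dots> \<le> (3 ^ r) ^ (\<Prod>i=1..r. 2 ^ i + 1)"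
  proof (rule power_increasing)
    show "(\<Prod>i=1..omega n. 2 ^ i + 1 :: nat) \<le> (\<Prod>i=1..r. 2 ^ i + 1)"
      using assms(4) by (intro dvd_imp_le prod_dvd_prod_subset prod_pos) auto
  qed simp
  also have "\<dots> = 3 ^ (r * (\<Prod>i=1..r. 2 ^ i + 1))" by (simp only: power_mult)
  finally have "Suc (multiplicity q n) \<le> r * (\<Prod>i=1..r. 2 ^ i + 1)"
    by (rule power_le_imp_le_exp [rotated]) simp
  also have "\<dots> \<le> 2 ^ (r\<^sup>2 + 1)" using \<open>r \<ge> 1\<close> by (rule prod_two_power_plus_one_le)
  finally show ?thesis by simp
qed

section \<open>Counting solutions whose primes are all large\<close>

text \<open>The reciprocals of the primes sum to at most \<open>r / (2 * r + 1)\<close>, which is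
  below 1/2. Hence the product of \<open>1 - 1 / p\<close> exceeds 1/2, and
  \<open>sigma_ratio_less\<close> applies.\<close>

lemma sigma_less_double:
  fixes b r :: nat
  assumes "b > 0" "omega b \<le> r" and large: "\<And>p. p \<in> prime_factors b \<Longrightarrow> p > 2 * r"
  shows "sigma b < 2 * b"
proof (cases "b = 1")
  case False
  then have "b > 1" using assms by simp
  have "(\<Sum>p\<in>prime_factors b. 1 / real p) \<le> (\<Sum>p\<in>prime_factors b. 1 / (2 * real r + 1))"
  proof (intro sum_mono frac_le)
    fix p assume "p \<in> prime_factors b"
    then have "2 * r + 1 \<le> p" using large by fastforce
    then show "2 * real r + 1 \<le> real p" by linarith
  qed auto
  also have "\<dots> = real (omega b) / (2 * real r + 1)" by (simp add: omega_def)
  also have "\<dots> \<le> real r / (2 * real r + 1)" using assms(2) by (intro divide_right_mono) auto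
  also have "\<dots> < 1 / 2" by simp
  finally have "1 / 2 < 1 - (\<Sum>p\<in>prime_factors b. 1 / real p)" by simp
  also have "\<dots> \<le> (\<Prod>p\<in>prime_factors b. 1 - 1 / real p)"
  proof (rule prod_one_minus_ge)
    fix p assume "p \<in> prime_factors b"
    then have "p > 0" using large by fastforce
    then show "0 \<le> 1 / real p \<and> 1 / real p \<le> 1" by simp
  qed
  finally have "real (sigma b) / real b * (1 / 2) \<le> real (sigma b) / real b * (\<Prod>p\<in>prime_factors b. 1 - 1 / real p)"
    by (intro mult_left_mono) auto
  also have "\<dots> < 1" using \<open>b > 1\<close> by (rule sigma_ratio_less)
  finally show ?thesis using \<open>b > 0\<close> by (simp add: field_simps)
qed simp

text \<open>The fraction \<open>d / c\<close> need not be reduced, so splitting off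
  \<open>p ^ e\<close> simply multiplies \<open>c\<close> by \<open>sigma (p ^ e)\<close> and
  \<open>d\<close> by \<open>p ^ e\<close>.\<close>

definition rough_solutions :: "nat \<Rightarrow> nat \<Rightarrow> nat \<Rightarrow> nat \<Rightarrow> nat \<Rightarrow> nat set" where
  "rough_solutions y E c d j = {b. b > 0 \<and> c * sigma b = d * b \<and> omega b \<le> j \<and>
     (\<forall>p\<in>prime_factors b. p > y \<and> multiplicity p b < E)}"

text \<open>The reduced denominator \<open>u\<close> of \<open>d / c\<close> depends only on
  \<open>c\<close> and \<open>d\<close> and divides every solution. If it were 1,
  \<open>sigma b / b\<close> would be an integer strictly between 1 and 2; so \<open>u\<close> has a
  prime factor.\<close>

lemma common_prime_divisor:
  assumes "c > 0" "j \<le> r" "b \<in> rough_solutions (2 * r) E c d j" "b \<noteq> 1"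
  obtains p where "prime p" "\<And>b. b \<in> rough_solutions (2 * r) E c d j \<Longrightarrow> p dvd b"
proof -
  define g where "g = gcd c d"
  obtain u v where uv: "c = u * g" "d = v * g" "coprime u v"
    using gcd_coprime_exists [of c d] \<open>c > 0\<close> unfolding g_def by auto
  have "g > 0" using \<open>c > 0\<close> by (simp add: g_def)
  have eq: "u * sigma b = v * b" if "b \<in> rough_solutions (2 * r) E c d j" for b
  proof -
    have "g * (u * sigma b) = g * (v * b)"
      using that unfolding rough_solutions_def uv(1,2) by (simp add: ac_simps)
    then show ?thesis using \<open>g > 0\<close> by simp
  qed
  have dvd: "u dvd b" if "b \<in> rough_solutions (2 * r) E c d j" for b
  proof -
    have "u dvd v * b" using eq [OF that] by (metis dvd_triv_left)
    then show ?thesis using uv(3) by (simp add: coprime_dvd_mult_right_iff)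
  qed
  have "u \<noteq> 1"
  proof
    assume "u = 1"
    then have "sigma b = v * b" using eq [OF assms(3)] by simp
    moreover have "b < sigma b" using assms(3,4) by (intro sigma_gt) (auto simp: rough_solutions_def)
    moreover have "sigma b < 2 * b"
      using assms(2,3) by (intro sigma_less_double [of _ r]) (auto simp: rough_solutions_def)
    ultimately have "1 < v" "v < 2" by auto
    then show False by simp
  qed
  then obtain p where "prime p" "p dvd u" using prime_factor_nat by blast
  with dvd that show thesis by (meson dvd_trans)
qed

text \<open>A prime common to all solutions leaves \<open>E\<close> choices for its exponent, and
  the cofactor solves an equation of the same kind with one prime fewer. The threshold
  \<open>2 * r\<close> stays fixed while \<open>j\<close> decreases.\<close>

lemma card_rough_solutions_le:
  assumes "E > 0" "c > 0" "j \<le> r"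
  shows "finite (rough_solutions (2 * r) E c d j) \<and> card (rough_solutions (2 * r) E c d j) \<le> E ^ j"
  using assms(2,3)
proof (induction j arbitrary: c d)
  case 0
  have "rough_solutions (2 * r) E c d 0 \<subseteq> {1}"
    by (auto simp: rough_solutions_def omega_def prime_factorization_empty_iff)
  then show ?case using card_mono [of "{1 :: nat}"] finite_subset by fastforce
next
  case (Suc j)
  define X where "X = rough_solutions (2 * r) E c d (Suc j)"
  show ?case
  \<comment> \<open>A common prime is available only when some solution differs from 1; otherwise
    there is at most one solution.\<close>
  proof (cases "X \<subseteq> {1}")
    case True
    then have "card X \<le> 1" using card_mono [of "{1 :: nat}" X] by simp
    also have "\<dots> \<le> E ^ Suc j" using \<open>E > 0\<close> by (simp add: Suc_le_eq)
    finally show ?thesis using True finite_subset unfolding X_def by blast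
  next
    case False
    then obtain b where "b \<in> X" "b \<noteq> 1" by blast
    then obtain p where p: "prime p" "\<And>b. b \<in> X \<Longrightarrow> p dvd b"
      using common_prime_divisor [OF Suc.prems] unfolding X_def by blast
    define Y where "Y e = rough_solutions (2 * r) E (c * sigma (p ^ e)) (d * p ^ e) j" for e
    have IH: "finite (Y e) \<and> card (Y e) \<le> E ^ j" for e
      unfolding Y_def using Suc.prems p(1)
      by (intro Suc.IH) (auto simp: sigma_pos prime_gt_0_nat)
    have "X \<subseteq> (\<Union>e<E. (\<lambda>m. p ^ e * m) ` Y e)"
    proof
      fix b assume b: "b \<in> X"
      then have "b > 0" by (simp add: X_def rough_solutions_def)
      then have pb: "p \<in> prime_factors b" using p b by (simp add: in_prime_factors_iff)
      define e where "e = multiplicity p b"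
      obtain m where m: "b = p ^ e * m" "m > 0" "coprime (p ^ e) m"
        "prime_factors m = prime_factors b - {p}" "omega b = Suc (omega m)"
        "\<And>q. q \<in> prime_factors m \<Longrightarrow> multiplicity q m = multiplicity q b"
        using prime_power_cofactor [OF \<open>b > 0\<close> pb] unfolding e_def by metis
      have "e < E" using b pb unfolding X_def rough_solutions_def e_def by blast
      have b': "c * sigma b = d * b" "omega b \<le> Suc j"
        "\<And>q. q \<in> prime_factors b \<Longrightarrow> q > 2 * r \<and> multiplicity q b < E"
        using b unfolding X_def rough_solutions_def by blast+
      have "c * sigma (p ^ e) * sigma m = d * p ^ e * m"
        using b'(1) sigma_mult [OF m(3)] by (subst (asm) (1 2) m(1)) (simp add: ac_simps)
      moreover have "omega m \<le> j" using b'(2) m(5) by simp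
      moreover have "q > 2 * r \<and> multiplicity q m < E" if "q \<in> prime_factors m" for q
        using b'(3) [of q] m(6) [OF that] that m(4) by auto
      ultimately have "m \<in> Y e" using \<open>m > 0\<close> unfolding Y_def rough_solutions_def by blast
      then show "b \<in> (\<Union>e<E. (\<lambda>m. p ^ e * m) ` Y e)" using m(1) \<open>e < E\<close> by blast
    qed
    moreover have "finite (\<Union>e<E. (\<lambda>m. p ^ e * m) ` Y e)" using IH by blast
    moreover have "card (\<Union>e<E. (\<lambda>m. p ^ e * m) ` Y e) \<le> E ^ Suc j"
    proof -
      have "card (\<Union>e<E. (\<lambda>m. p ^ e * m) ` Y e) \<le> (\<Sum>e<E. card ((\<lambda>m. p ^ e * m) ` Y e))"
        by (rule card_UN_le) simp
      also have "\<dots> \<le> (\<Sum>e<E. E ^ j)"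
        using IH card_image_le le_trans by (intro sum_mono) blast
      finally show ?thesis by simp
    qed
    ultimately show ?thesis unfolding X_def by (meson card_mono finite_subset le_trans)
  qed
qed

section \<open>Splitting off the small primes and the final count\<close>

lemma smooth_rough_decomposition:
  fixes n y :: nat
  assumes "n > 0"
  defines "S \<equiv> {p \<in> prime_factors n. p \<le> y}"
  obtains b where "n = (\<Prod>p\<in>S. p ^ multiplicity p n) * b" "b > 0"
    "sigma n = sigma (\<Prod>p\<in>S. p ^ multiplicity p n) * sigma b"
    "prime_factors b = {p \<in> prime_factors n. p > y}"
    "\<forall>p\<in>prime_factors b. multiplicity p b = multiplicity p n"
proof -
  define T where "T = {p \<in> prime_factors n. p > y}"
  define b where "b = (\<Prod>p\<in>T. p ^ multiplicity p n)"
  have fin: "finite S" "finite T" by (simp_all add: S_def T_def)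
  have un: "prime_factors n = S \<union> T" and disj: "S \<inter> T = {}" by (auto simp: S_def T_def)
  have prime: "prime p" if "p \<in> S \<union> T" for p using that unfolding un [symmetric] by auto
  have n: "n = (\<Prod>p\<in>S \<union> T. p ^ multiplicity p n)"
    using prime_factorization_nat [OF \<open>n > 0\<close>] by (simp only: un)
  have mult: "multiplicity p b = (if p \<in> T then multiplicity p n else 0)" if "prime p" for p
    unfolding b_def using that fin prime by (intro multiplicity_prod_prime_powers) auto
  have mult_pos: "multiplicity p n > 0" if "p \<in> T" for p
    using that by (simp add: T_def prime_factors_multiplicity)
  have pf: "prime_factors b = T"
  proof (intro equalityI subsetI)
    fix p assume "p \<in> prime_factors b"
    then have "prime p" "multiplicity p b > 0" by (simp_all add: prime_factors_multiplicity)
    then show "p \<in> T" using mult [of p] by presburger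
  next
    fix p assume "p \<in> T"
    then have "prime p" "multiplicity p b > 0" using mult [of p] mult_pos prime [of p] by auto
    then show "p \<in> prime_factors b" by (simp add: prime_factors_multiplicity)
  qed
  show thesis
  proof (rule that)
    show "n = (\<Prod>p\<in>S. p ^ multiplicity p n) * b"
      using n fin disj by (simp add: b_def prod.union_disjoint)
    show "b > 0" unfolding b_def using prime prime_gt_0_nat by (intro prod_pos) auto
    have "sigma n = (\<Prod>p\<in>S \<union> T. sigma (p ^ multiplicity p n))"
      by (subst n, rule sigma_prod_prime_powers) (use fin prime in auto)
    also have "\<dots> = sigma (\<Prod>p\<in>S. p ^ multiplicity p n) * sigma b"
      unfolding b_def using fin disj prime by (simp add: prod.union_disjoint sigma_prod_prime_powers)
    finally show "sigma n = sigma (\<Prod>p\<in>S. p ^ multiplicity p n) * sigma b" .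
    show "prime_factors b = {p \<in> prime_factors n. p > y}" using pf by (simp add: T_def)
    show "\<forall>p\<in>prime_factors b. multiplicity p b = multiplicity p n"
      using mult prime unfolding pf by simp
  qed
qed

theorem theorem1:
  fixes k r :: nat
  assumes "k \<ge> 2" and "r \<ge> 1"
  shows "finite {n :: nat. n > 0 \<and> odd n \<and> sigma n = k * n \<and> omega n \<le> r} \<and>
         card {n :: nat. n > 0 \<and> odd n \<and> sigma n = k * n \<and> omega n \<le> r} \<le> k * 4 ^ (r ^ 3)"
proof -
  define N where "N = {n :: nat. n > 0 \<and> odd n \<and> sigma n = k * n \<and> omega n \<le> r}"
  define E :: nat where "E = 2 ^ (r\<^sup>2 + 1)"
  \<comment> \<open>The odd numbers from 3 to \<open>2 * r - 1\<close>. They include every odd prime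
    up to \<open>2 * r\<close>, and there are only \<open>r - 1\<close> of them; composite members
    merely enlarge the set of codes \<open>f\<close>.\<close>
  define I where "I = (\<lambda>i :: nat. 2 * i + 1) ` {1..<r}"
  define val where "val f = (\<Prod>i\<in>I. i ^ f i)" for f :: "nat \<Rightarrow> nat"
  \<comment> \<open>For \<open>n = A * b\<close> with coprime parts, \<open>sigma n = k * n\<close>
    reads \<open>sigma A * sigma b = k * A * b\<close>.\<close>
  define Y where "Y A = rough_solutions (2 * r) E (sigma A) (k * A) r" for A
  have "E > 0" by (simp add: E_def)
  have [simp]: "finite I" by (simp add: I_def)
  have card_I: "card I = r - 1" by (simp add: I_def card_image inj_on_def)
  have fin_F: "finite (PiE I (\<lambda>_. {..<E}))" by (intro finite_PiE) auto
  have Y: "finite (Y (val f)) \<and> card (Y (val f)) \<le> E ^ r" for f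
    unfolding Y_def
  proof (rule card_rough_solutions_le)
    have "val f > 0" unfolding val_def by (intro prod_pos) (auto simp: I_def)
    then show "sigma (val f) > 0" by (rule sigma_pos)
  qed (use \<open>E > 0\<close> in auto)
  have sub: "N \<subseteq> (\<Union>f\<in>PiE I (\<lambda>_. {..<E}). (\<lambda>b. val f * b) ` Y (val f))"
  proof
    fix n assume "n \<in> N"
    then have n: "n > 0" "odd n" "sigma n = k * n" "omega n \<le> r" by (auto simp: N_def)
    define S where "S = {p \<in> prime_factors n. p \<le> 2 * r}"
    define A where "A = (\<Prod>p\<in>S. p ^ multiplicity p n)"
    obtain b where b: "n = A * b" "b > 0" "sigma n = sigma A * sigma b"
      "prime_factors b = {p \<in> prime_factors n. p > 2 * r}"
      "\<forall>p\<in>prime_factors b. multiplicity p b = multiplicity p n"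
      by (rule smooth_rough_decomposition [OF \<open>n > 0\<close>, of "2 * r", folded S_def, folded A_def])
    have mult_less: "multiplicity p n < E" if "p \<in> prime_factors n" for p
      unfolding E_def using n that by (rule multiplicity_bound)
    \<comment> \<open>Exponent 0 outside \<open>S\<close> contributes a factor 1 and is admissible
      because \<open>E > 0\<close>; the restriction to \<open>I\<close> puts \<open>f\<close> into
      the extensional function space being counted.\<close>
    define f where "f = restrict (\<lambda>p. if p \<in> S then multiplicity p n else 0) I"
    have "S \<subseteq> I"
    proof
      fix p assume "p \<in> S"
      then have "prime p" "p dvd n" "p \<le> 2 * r" by (auto simp: S_def)
      then have "odd p" "p \<ge> 2" using \<open>odd n\<close> dvd_trans prime_ge_2_nat by blast+
      then obtain i where "p = 2 * i + 1" by (elim oddE)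
      then show "p \<in> I" using \<open>p \<ge> 2\<close> \<open>p \<le> 2 * r\<close> by (auto simp: I_def)
    qed
    have "val f = A"
      unfolding val_def A_def f_def using \<open>S \<subseteq> I\<close>
      by (intro prod.mono_neutral_cong_right) auto
    moreover have "f \<in> PiE I (\<lambda>_. {..<E})"
      using mult_less \<open>E > 0\<close> by (auto simp: f_def S_def)
    moreover have "b \<in> Y A"
    proof -
      have "sigma A * sigma b = k * A * b" using b(1,3) n(3) by simp
      moreover have "omega b \<le> omega n"
        unfolding omega_def by (rule card_mono) (use b(4) in auto)
      moreover have "p > 2 * r \<and> multiplicity p b < E" if "p \<in> prime_factors b" for p
        using b(5) that b(4) mult_less [of p] by auto
      ultimately show ?thesis
        using \<open>b > 0\<close> n(4) le_trans unfolding Y_def rough_solutions_def by blast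
    qed
    ultimately show "n \<in> (\<Union>f\<in>PiE I (\<lambda>_. {..<E}). (\<lambda>b. val f * b) ` Y (val f))"
      using b(1) by blast
  qed
  have fin: "finite (\<Union>f\<in>PiE I (\<lambda>_. {..<E}). (\<lambda>b. val f * b) ` Y (val f))"
    using Y fin_F by blast
  have "card N \<le> card (\<Union>f\<in>PiE I (\<lambda>_. {..<E}). (\<lambda>b. val f * b) ` Y (val f))"
    using fin sub by (rule card_mono)
  also have "\<dots> \<le> (\<Sum>f\<in>PiE I (\<lambda>_. {..<E}). card ((\<lambda>b. val f * b) ` Y (val f)))"
    using fin_F by (rule card_UN_le)
  also have "\<dots> \<le> (\<Sum>f\<in>PiE I (\<lambda>_. {..<E}). E ^ r)"
    using Y card_image_le le_trans by (intro sum_mono) blast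
  also have "\<dots> = E ^ (r - 1) * E ^ r" by (simp add: card_PiE card_I)
  also have "\<dots> = 2 ^ ((r\<^sup>2 + 1) * (r - 1 + r))"
    by (simp only: E_def power_mult power_add)
  \<comment> \<open>The exponent on the left equals \<open>2 * r ^ 3 - (r - 1) ^ 2\<close>. Writing
    \<open>r = Suc s\<close> removes the truncated subtraction.\<close>
  also have "\<dots> \<le> 2 ^ (2 * r ^ 3)"
  proof (rule power_increasing)
    obtain s where "r = Suc s" using \<open>r \<ge> 1\<close> by (cases r) auto
    then show "(r\<^sup>2 + 1) * (r - 1 + r) \<le> 2 * r ^ 3"
      by (simp add: power2_eq_square power3_eq_cube algebra_simps)
  qed simp
  also have "\<dots> = 4 ^ r ^ 3" by (simp add: power_mult)
  also have "\<dots> \<le> k * 4 ^ r ^ 3" using \<open>k \<ge> 2\<close> by simp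
  finally show ?thesis using finite_subset [OF sub fin] unfolding N_def by blast
qed

end
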